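(* Let $G$ be a finite simple undirected graph which has no induced subgraph isomorphic to any of $C_4$, $C_5$, $C_6$, $S_3$. Then every (nonempty) clique in $G^2$ is contained in a set of the form $N_G[v]$ for some vertex $v$ of $G$.
   Context: All graphs are simple, finite and undirected. $G^2$ is the graph on $V(G)$ in which two distinct vertices are adjacent iff their distance in $G$ is at most $2$. $N_G[v]=\{v\}\cup\{w: vw\in E(G)\}$. $C_n$ is the cycle with $n$ vertices. $S_3$ is the $3$-sun: the graph with six vertices $a_1,a_2,a_3,b_1,b_2,b_3$ in which $a_1,a_2,a_3$ are pairwise adjacent, each $b_i$ is adjacent to exactly the two vertices $a_j$ with $j\neq i$, and there are no other edges. *)

theory Defs
  imports
    "Graph_Theory.Pair_Digraph"
    "Graph_Theory.Digraph_Component"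
    "Graph_Theory.Digraph_Isomorphism"
    "Graph_Theory.Shortest_Path"
begin

text \<open>
  A finite simple undirected graph is a \<open>pair_graph\<close>: a finite, loop-free digraph without
  parallel arcs whose set of arcs is symmetric, so that an edge $uv$ is the pair of arcs
  \<open>(u, v)\<close> and \<open>(v, u)\<close>. The empty graph is allowed.
\<close>

definition has_induced_copy :: "'a pair_pre_digraph \<Rightarrow> 'b pair_pre_digraph \<Rightarrow> bool" where
  "has_induced_copy G H \<longleftrightarrow>
    (\<exists>K. induced_subgraph K (with_proj G) \<and> digraph_iso K (with_proj H))"

text \<open>This is the cycle $C_n$ only for $n \ge 3$ (for smaller $n$ it has a loop or a single edge).\<close>

definition cycle_graph :: "nat \<Rightarrow> nat pair_pre_digraph" where
  "cycle_graph n = \<lparr> pverts = {..<n},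
     parcs = {(i, j). i < n \<and> j < n \<and> (j = (i + 1) mod n \<or> i = (j + 1) mod n)} \<rparr>"

datatype sun_vertex = A nat | B nat

definition sun3 :: "sun_vertex pair_pre_digraph" where
  "sun3 = \<lparr> pverts = A ` {1, 2, 3} \<union> B ` {1, 2, 3},
     parcs = (\<Union>i\<in>{1, 2, 3}. \<Union>j\<in>{1, 2, 3} - {i}. {(A i, A j), (A i, B j), (B i, A j)}) \<rparr>"

text \<open>With all arcs of weight 1, \<open>\<mu>\<close> is the graph distance (\<open>\<infinity>\<close> between different components).\<close>

definition graph_dist :: "'a pair_pre_digraph \<Rightarrow> 'a \<Rightarrow> 'a \<Rightarrow> ereal" where
  "graph_dist G = wf_digraph.\<mu> (with_proj G) (\<lambda>_. 1)"

definition square :: "'a pair_pre_digraph \<Rightarrow> 'a pair_pre_digraph" where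
  "square G = \<lparr> pverts = pverts G,
     parcs = {(u, v). u \<in> pverts G \<and> v \<in> pverts G \<and> u \<noteq> v \<and> graph_dist G u v \<le> 2} \<rparr>"

definition clique :: "'a pair_pre_digraph \<Rightarrow> 'a set \<Rightarrow> bool" where
  "clique G C \<longleftrightarrow> C \<subseteq> pverts G \<and> (\<forall>u\<in>C. \<forall>v\<in>C. u \<noteq> v \<longrightarrow> (u, v) \<in> parcs G)"

definition closed_nbhd :: "'a pair_pre_digraph \<Rightarrow> 'a \<Rightarrow> 'a set" where
  "closed_nbhd G v = {v} \<union> {w. (v, w) \<in> parcs G}"

lemma pair_graph_cycle_graph:
  assumes "n \<ge> 3"
  shows "pair_graph (cycle_graph n)"
proof
  show "finite (parcs (cycle_graph n))"
    by (rule finite_subset[of _ "{..<n} \<times> {..<n}"]) (auto simp: cycle_graph_def)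
  show "fst e \<noteq> snd e" if "e \<in> parcs (cycle_graph n)" for e
    using that assms by (cases "Suc (fst e) < n") (auto simp: cycle_graph_def mod_Suc split: if_splits)
qed (auto simp: cycle_graph_def symmetric_def sym_def)

lemma pair_graph_sun3: "pair_graph sun3"
  by standard (auto simp: sun3_def symmetric_def sym_def)

lemma graph_dist_le_2_iff:
  assumes "pair_graph G" "u \<in> pverts G" "v \<in> pverts G" "u \<noteq> v"
  shows "graph_dist G u v \<le> 2 \<longleftrightarrow>
    (u, v) \<in> parcs G \<or> (\<exists>w. (u, w) \<in> parcs G \<and> (w, v) \<in> parcs G)"
proof -
  interpret pair_graph G by fact
  have cost: "awalk_cost (\<lambda>_. 1) p = real (length p)" for p :: "('a \<times> 'a) list"
    by (induct p) auto
  show ?thesis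
  proof
    assume le: "graph_dist G u v \<le> 2"
    have "\<exists>p. awalk u p v \<and> length p \<le> 2"
    proof (rule ccontr)
      assume "\<not> ?thesis"
      then have "ereal 3 \<le> ereal (awalk_cost (\<lambda>_. 1) p)" if "awalk u p v" for p
        using that by (fastforce simp: cost)
      then have "ereal 3 \<le> \<mu> (\<lambda>_. 1) u v"
        unfolding \<mu>_def by (auto intro!: INF_greatest)
      also have "\<dots> \<le> 2"
        using le by (simp add: graph_dist_def)
      finally have "ereal 3 \<le> 2" .
      then show False by simp
    qed
    then obtain p where p: "awalk u p v" "length p \<le> 2" by blast
    then show "(u, v) \<in> parcs G \<or> (\<exists>w. (u, w) \<in> parcs G \<and> (w, v) \<in> parcs G)"
      using assms(4)
      by (cases p rule: list.exhaust; cases "tl p" rule: list.exhaust)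
        (auto simp: awalk_Cons_iff awalk_Nil_iff)
  next
    assume "(u, v) \<in> parcs G \<or> (\<exists>w. (u, w) \<in> parcs G \<and> (w, v) \<in> parcs G)"
    then obtain p where p: "awalk u p v" "length p \<le> 2"
    proof
      assume "(u, v) \<in> parcs G"
      then have "awalk u [(u, v)] v" using assms by (simp add: awalk_Cons_iff awalk_Nil_iff)
      then show ?thesis using that by force
    next
      assume "\<exists>w. (u, w) \<in> parcs G \<and> (w, v) \<in> parcs G"
      then obtain w where "(u, w) \<in> parcs G" "(w, v) \<in> parcs G" by blast
      then have "awalk u [(u, w), (w, v)] v"
        using assms by (simp add: awalk_Cons_iff awalk_Nil_iff)
      then show ?thesis using that by force
    qed
    have "\<mu> (\<lambda>_. 1) u v \<le> ereal (real (length p))"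
      using min_cost_le_walk_cost[OF p(1), of "\<lambda>_. 1"] by (simp add: cost)
    also have "\<dots> \<le> ereal 2" using p(2) by simp
    finally show "graph_dist G u v \<le> 2" by (simp add: graph_dist_def)
  qed
qed

lemma pair_graph_square:
  assumes "pair_graph G"
  shows "pair_graph (square G)"
proof -
  interpret pair_graph G by fact
  have dist_sym: "graph_dist G v u \<le> 2"
    if "u \<in> pverts G" "v \<in> pverts G" "u \<noteq> v" "graph_dist G u v \<le> 2" for u v
    using that(4) unfolding graph_dist_le_2_iff[OF assms that(1-3)]
      graph_dist_le_2_iff[OF assms that(2,1) that(3)[symmetric]]
    by (meson arcs_symmetric)
  show ?thesis
  proof
    show "finite (parcs (square G))"
      by (rule finite_subset[of _ "pverts G \<times> pverts G"]) (auto simp: square_def)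
    show "symmetric (with_proj (square G))"
      using dist_sym by (auto simp: symmetric_def sym_def square_def simp del: numeral_eq_ereal)
  qed (auto simp: square_def)
qed

lemma has_induced_copy_iff:
  assumes "pair_graph G" "pair_graph H"
  shows "has_induced_copy G H \<longleftrightarrow>
    (\<exists>f. inj_on f (pverts H) \<and> f ` pverts H \<subseteq> pverts G \<and>
      (\<forall>x\<in>pverts H. \<forall>y\<in>pverts H. (x, y) \<in> parcs H \<longleftrightarrow> (f x, f y) \<in> parcs G))"
proof -
  interpret G: pair_graph G by fact
  interpret H: pair_graph H by fact
  show ?thesis
  proof
    assume "has_induced_copy G H"
    then obtain K h where K: "induced_subgraph K (with_proj G)"
      and h: "pre_digraph.digraph_isomorphism K h" and H: "with_proj H = app_iso h K"
      unfolding has_induced_copy_def digraph_iso_def by blast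
    from K have wfK: "wf_digraph K" and "verts K \<subseteq> pverts G"
      and th: "tail K = fst" "head K = snd"
      and aK: "arcs K = {e \<in> parcs G. fst e \<in> verts K \<and> snd e \<in> verts K}"
      by (auto simp: induced_subgraph_def subgraph_def compatible_def)
    have vH: "pverts H = iso_verts h ` verts K"
      using arg_cong[OF H, of verts] by simp
    have aH: "parcs H = (\<lambda>(u, v). (iso_verts h u, iso_verts h v)) ` arcs K"
      using arg_cong[OF H, of arcs_ends] wf_digraph.arcs_ends_app_iso_eq[OF wfK h]
      by (simp add: arcs_ends_conv[of K] th)
    have inj: "inj_on (iso_verts h) (verts K)"
      using pre_digraph.digraph_isomorphism_inj_on_verts[OF h] .
    let ?f = "the_inv_into (verts K) (iso_verts h)"
    have fv: "?f (iso_verts h v) = v" if "v \<in> verts K" for v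
      using the_inv_into_f_f[OF inj that] .
    have "(iso_verts h u, iso_verts h v) \<in> parcs H \<longleftrightarrow> (u, v) \<in> parcs G"
      if "u \<in> verts K" "v \<in> verts K" for u v
      using that inj by (auto simp: aH aK image_iff inj_on_def)
    then have "inj_on ?f (pverts H) \<and> ?f ` pverts H \<subseteq> pverts G \<and>
      (\<forall>x\<in>pverts H. \<forall>y\<in>pverts H. (x, y) \<in> parcs H \<longleftrightarrow> (?f x, ?f y) \<in> parcs G)"
      using \<open>verts K \<subseteq> pverts G\<close> by (auto simp: vH inj_on_def fv)
    then show "\<exists>f. inj_on f (pverts H) \<and> f ` pverts H \<subseteq> pverts G \<and>
      (\<forall>x\<in>pverts H. \<forall>y\<in>pverts H. (x, y) \<in> parcs H \<longleftrightarrow> (f x, f y) \<in> parcs G)" by blast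
  next
    assume "\<exists>f. inj_on f (pverts H) \<and> f ` pverts H \<subseteq> pverts G \<and>
      (\<forall>x\<in>pverts H. \<forall>y\<in>pverts H. (x, y) \<in> parcs H \<longleftrightarrow> (f x, f y) \<in> parcs G)"
    then obtain f where inj: "inj_on f (pverts H)" and sub: "f ` pverts H \<subseteq> pverts G"
      and adj: "\<And>x y. x \<in> pverts H \<Longrightarrow> y \<in> pverts H \<Longrightarrow>
        (x, y) \<in> parcs H \<longleftrightarrow> (f x, f y) \<in> parcs G"
      by blast
    let ?K = "with_proj G \<restriction> (f ` pverts H)"
    let ?g = "the_inv_into (pverts H) f"
    define h where "h = \<lparr> iso_verts = ?g, iso_arcs = (\<lambda>(u, v). (?g u, ?g v)),
      iso_head = snd, iso_tail = fst \<rparr>"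
    have g: "?g (f x) = x" if "x \<in> pverts H" for x
      using the_inv_into_f_f[OF inj that] .
    have K: "induced_subgraph ?K (with_proj G)"
      using sub by (intro G.induced_induce) simp
    then have wfK: "wf_digraph ?K" by (simp add: induced_subgraph_def subgraph_def)
    have "pre_digraph.digraph_isomorphism ?K h"
      using wfK g
      by (auto simp: pre_digraph.digraph_isomorphism_def h_def inj_on_def induce_subgraph_def)
    moreover have "with_proj H = app_iso h ?K"
    proof -
      have "parcs H = (\<lambda>(u, v). (?g u, ?g v)) `
          {e \<in> parcs G. fst e \<in> f ` pverts H \<and> snd e \<in> f ` pverts H}" (is "_ = ?R")
      proof
        show "parcs H \<subseteq> ?R"
        proof
          fix e assume e: "e \<in> parcs H"
          obtain x y where xy: "e = (x, y)" by (cases e)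
          with e have "x \<in> pverts H" "y \<in> pverts H" by (auto dest: H.wellformed')
          with e show "e \<in> ?R" unfolding xy
            by (intro image_eqI[of _ _ "(f x, f y)"]) (auto simp: g adj)
        qed
        show "?R \<subseteq> parcs H" by (auto simp: g adj)
      qed
      then show ?thesis
        by (auto simp: app_iso_def h_def with_proj_def induce_subgraph_def image_image g)
    qed
    ultimately show "has_induced_copy G H"
      using K unfolding has_induced_copy_def digraph_iso_def by blast
  qed
qed

end

theory Submission
  imports Defs
begin

text \<open>
  Vertices are at distance at most 2 iff their closed neighbourhoods intersect, so the claim is
  a Helly property of closed neighbourhoods. In a minimal counterexample \<open>C\<close> every \<open>C - {c}\<close>
  lies in a closed neighbourhood, of \<open>v\<close> say, and \<open>c\<close> does not. Three elements
  \<open>c\<^sub>1\<close>, \<open>c\<^sub>2\<close>, \<open>c\<^sub>3\<close> with their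
  \<open>v\<^sub>1\<close>, \<open>v\<^sub>2\<close>, \<open>v\<^sub>3\<close> form a hexagon
  \<open>c\<^sub>1 v\<^sub>3 c\<^sub>2 v\<^sub>1 c\<^sub>3 v\<^sub>2\<close>, possibly with coinciding neighbours, whose long diagonals
  are non-edges. Whatever its short diagonals are, one of the four forbidden graphs is induced.
\<close>

section \<open>Recognising the four forbidden graphs from adjacencies\<close>

lemma has_induced_copy_cycle_graph:
  assumes "pair_graph G" "n \<ge> 3" "length xs = n" "distinct xs" "set xs \<subseteq> pverts G"
    and "\<forall>i\<in>{..<n}. \<forall>j\<in>{..<n}.
      (xs ! i, xs ! j) \<in> parcs G \<longleftrightarrow> j = (i + 1) mod n \<or> i = (j + 1) mod n"
  shows "has_induced_copy G (cycle_graph n)"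
proof -
  have "inj_on ((!) xs) {..<n}"
    using assms(3,4) by (auto intro: inj_on_nth)
  moreover have "(!) xs ` {..<n} \<subseteq> pverts G"
    using assms(3,5) by (auto simp: subset_iff)
  ultimately show ?thesis
    using assms(6) unfolding has_induced_copy_iff[OF assms(1) pair_graph_cycle_graph[OF assms(2)]]
    by (intro exI[of _ "(!) xs"]) (simp add: cycle_graph_def)
qed

context pair_graph
begin

lemma no_loop: "(a, a) \<notin> parcs G"
  using no_loops'[of a a] by blast

lemma parcs_sym_iff: "(a, b) \<in> parcs G \<longleftrightarrow> (b, a) \<in> parcs G"
  by (meson arcs_symmetric)

lemma not_parcs_sym: "(a, b) \<notin> parcs G \<Longrightarrow> (b, a) \<notin> parcs G"
  by (metis arcs_symmetric)

text \<open>Opposite vertices of a 4-cycle have the same neighbours on it, so adjacencies alone do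
  not separate them and \<open>a \<noteq> c\<close>, \<open>b \<noteq> d\<close> are assumed. In
  \<open>has_induced_C5\<close>, \<open>has_induced_C6\<close> and \<open>has_induced_sun3\<close>
  distinctness follows from the adjacencies.\<close>

lemma has_induced_C4:
  assumes "(a, b) \<in> parcs G" "(b, c) \<in> parcs G" "(c, d) \<in> parcs G" "(d, a) \<in> parcs G"
    and "a \<noteq> c" "b \<noteq> d" "(a, c) \<notin> parcs G" "(b, d) \<notin> parcs G"
  shows "has_induced_copy G (cycle_graph 4)"
proof -
  have "set [a, b, c, d] \<subseteq> pverts G"
    using assms by (auto dest: in_arcsD1 in_arcsD2)
  moreover have "distinct [a, b, c, d]"
    using assms no_loop by auto
  moreover have "{..<4::nat} = {0, 1, 2, 3}"
    by auto
  ultimately show ?thesis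
    using assms assms(1-4)[THEN arcs_symmetric] assms(7-8)[THEN not_parcs_sym]
    by (intro has_induced_copy_cycle_graph[OF pair_graph_axioms, of _ "[a, b, c, d]"])
      (simp_all add: no_loop)
qed

lemma has_induced_C5:
  assumes "(a, b) \<in> parcs G" "(b, c) \<in> parcs G" "(c, d) \<in> parcs G" "(d, e) \<in> parcs G"
      "(e, a) \<in> parcs G"
    and "(a, c) \<notin> parcs G" "(a, d) \<notin> parcs G" "(b, d) \<notin> parcs G" "(b, e) \<notin> parcs G"
      "(c, e) \<notin> parcs G"
  shows "has_induced_copy G (cycle_graph 5)"
proof -
  have "set [a, b, c, d, e] \<subseteq> pverts G"
    using assms by (auto dest: in_arcsD1 in_arcsD2)
  moreover have "distinct [a, b, c, d, e]"
    using assms no_loop parcs_sym_iff by auto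
  moreover have "{..<5::nat} = {0, 1, 2, 3, 4}"
    by auto
  ultimately show ?thesis
    using assms assms(1-5)[THEN arcs_symmetric] assms(6-10)[THEN not_parcs_sym]
    by (intro has_induced_copy_cycle_graph[OF pair_graph_axioms, of _ "[a, b, c, d, e]"])
      (simp_all add: no_loop)
qed

lemma has_induced_C6:
  assumes "(a, b) \<in> parcs G" "(b, c) \<in> parcs G" "(c, d) \<in> parcs G" "(d, e) \<in> parcs G"
      "(e, f) \<in> parcs G" "(f, a) \<in> parcs G"
    and "(a, c) \<notin> parcs G" "(a, d) \<notin> parcs G" "(a, e) \<notin> parcs G" "(b, d) \<notin> parcs G"
      "(b, e) \<notin> parcs G" "(b, f) \<notin> parcs G" "(c, e) \<notin> parcs G" "(c, f) \<notin> parcs G"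
      "(d, f) \<notin> parcs G"
  shows "has_induced_copy G (cycle_graph 6)"
proof -
  have "set [a, b, c, d, e, f] \<subseteq> pverts G"
    using assms by (auto dest: in_arcsD1 in_arcsD2)
  moreover have "distinct [a, b, c, d, e, f]"
    using assms no_loop parcs_sym_iff by auto
  moreover have "{..<6::nat} = {0, 1, 2, 3, 4, 5}"
    by auto
  ultimately show ?thesis
    using assms assms(1-6)[THEN arcs_symmetric] assms(7-15)[THEN not_parcs_sym]
    by (intro has_induced_copy_cycle_graph[OF pair_graph_axioms, of _ "[a, b, c, d, e, f]"])
      (simp_all add: no_loop)
qed

lemma has_induced_sun3:
  assumes "(a1, a2) \<in> parcs G" "(a2, a3) \<in> parcs G" "(a1, a3) \<in> parcs G"
    and "(a2, b1) \<in> parcs G" "(a3, b1) \<in> parcs G" "(a1, b2) \<in> parcs G" "(a3, b2) \<in> parcs G"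
      "(a1, b3) \<in> parcs G" "(a2, b3) \<in> parcs G"
    and "(a1, b1) \<notin> parcs G" "(a2, b2) \<notin> parcs G" "(a3, b3) \<notin> parcs G"
    and "(b1, b2) \<notin> parcs G" "(b2, b3) \<notin> parcs G" "(b1, b3) \<notin> parcs G"
  shows "has_induced_copy G sun3"
proof -
  \<comment> \<open>The sun is indexed from 1 and lists from 0, hence \<open>i - 1\<close>.\<close>
  let ?f = "\<lambda>x. case x of A i \<Rightarrow> [a1, a2, a3] ! (i - 1) | B i \<Rightarrow> [b1, b2, b3] ! (i - 1)"
  have d: "distinct [a1, a2, a3, b1, b2, b3]"
    using assms no_loop parcs_sym_iff by auto
  have v: "pverts sun3 = {A 1, A 2, A 3, B 1, B 2, B 3}"
    by (auto simp: sun3_def)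
  have "inj_on ?f (pverts sun3)"
    using d by (auto simp: v)
  moreover have "?f ` pverts sun3 \<subseteq> pverts G"
    using assms by (auto simp: v dest: in_arcsD1 in_arcsD2)
  moreover have "\<forall>x\<in>pverts sun3. \<forall>y\<in>pverts sun3.
      (x, y) \<in> parcs sun3 \<longleftrightarrow> (?f x, ?f y) \<in> parcs G"
    using assms assms(1-9)[THEN arcs_symmetric] assms(10-15)[THEN not_parcs_sym]
    unfolding v by (simp add: sun3_def no_loop)
  ultimately show ?thesis
    unfolding has_induced_copy_iff[OF pair_graph_axioms pair_graph_sun3] by blast
qed

section \<open>Hexagons and their short diagonals\<close>

lemma closed_nbhd_sym: "u \<in> closed_nbhd G v \<longleftrightarrow> v \<in> closed_nbhd G u"
  by (auto simp: closed_nbhd_def parcs_sym_iff)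

text \<open>Opposite vertices share their index. The short diagonals, within the \<open>c\<close>s
  and within the \<open>v\<close>s, are left open; the later lemmas decide them.\<close>

definition hexagon :: "'a \<Rightarrow> 'a \<Rightarrow> 'a \<Rightarrow> 'a \<Rightarrow> 'a \<Rightarrow> 'a \<Rightarrow> bool" where
  "hexagon c1 c2 c3 v1 v2 v3 \<longleftrightarrow>
    (c1, v2) \<in> parcs G \<and> (c1, v3) \<in> parcs G \<and> (c2, v1) \<in> parcs G \<and>
    (c2, v3) \<in> parcs G \<and> (c3, v1) \<in> parcs G \<and> (c3, v2) \<in> parcs G \<and>
    (c1, v1) \<notin> parcs G \<and> (c2, v2) \<notin> parcs G \<and> (c3, v3) \<notin> parcs G \<and>
    c1 \<noteq> v1 \<and> c2 \<noteq> v2 \<and> c3 \<noteq> v3"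

text \<open>With \<open>hexagon_swap\<close> and \<open>hexagon_flip\<close> this generates all
  twelve symmetries of the hexagon: permuting the indices and exchanging the \<open>c\<close>s with
  the \<open>v\<close>s.\<close>

lemma hexagon_rotate: "hexagon c1 c2 c3 v1 v2 v3 \<Longrightarrow> hexagon c2 c3 c1 v2 v3 v1"
  by (simp add: hexagon_def)

lemma hexagon_swap: "hexagon c1 c2 c3 v1 v2 v3 \<Longrightarrow> hexagon c2 c1 c3 v2 v1 v3"
  by (simp add: hexagon_def)

lemma hexagon_flip: "hexagon c1 c2 c3 v1 v2 v3 \<Longrightarrow> hexagon v1 v2 v3 c1 c2 c3"
  by (auto simp: hexagon_def intro: arcs_symmetric)

context
  assumes C4: "\<not> has_induced_copy G (cycle_graph 4)"
    and C5: "\<not> has_induced_copy G (cycle_graph 5)"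
    and C6: "\<not> has_induced_copy G (cycle_graph 6)"
    and S3: "\<not> has_induced_copy G sun3"
begin

text \<open>The case \<open>c\<^sub>1 = v\<^sub>2\<close> of two coinciding neighbours on the hexagon.\<close>

lemma hexagon_degenerate:
  assumes "c1 \<in> closed_nbhd G v3" "c2 \<in> closed_nbhd G v3" "c2 \<in> closed_nbhd G v1"
      "c3 \<in> closed_nbhd G v1" "c3 \<in> closed_nbhd G c1"
    and "c1 \<notin> closed_nbhd G v1" "c2 \<notin> closed_nbhd G c1" "c3 \<notin> closed_nbhd G v3"
  shows False
proof -
  have e: "(c1, c3) \<in> parcs G" "(c2, v3) \<in> parcs G" "(v3, c1) \<in> parcs G" "(c3, v1) \<in> parcs G"
    and n: "(c1, v1) \<notin> parcs G" "(c1, c2) \<notin> parcs G" "(c3, v3) \<notin> parcs G"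
      "c1 \<noteq> v1" "c1 \<noteq> c2" "c3 \<noteq> v3"
    using assms unfolding closed_nbhd_def by (auto simp: parcs_sym_iff)
  have 1: "(c3, c2) \<notin> parcs G"
    using has_induced_C4[of c1 c3 c2 v3] C4 e n by blast
  \<comment> \<open>\<open>c2 = v1\<close> is excluded because \<open>c3\<close> is adjacent to
    \<open>v1\<close> but not to \<open>c2\<close>.\<close>
  then have 2: "(v1, c2) \<in> parcs G"
    using assms(3) e unfolding closed_nbhd_def by auto
  have 3: "(v1, v3) \<notin> parcs G"
    using has_induced_C4[of c1 c3 v1 v3] C4 e n by blast
  show False
    using has_induced_C5[of c1 c3 v1 c2 v3] C5 e n 1 2 3 by blast
qed

text \<open>Otherwise \<open>c1 c2 v1 v2\<close> is a 4-cycle whose diagonals are long diagonals of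
  the hexagon.\<close>

lemma hexagon_c_edge_imp_not_v_edge:
  assumes "hexagon c1 c2 c3 v1 v2 v3" "(c1, c2) \<in> parcs G"
  shows "(v1, v2) \<notin> parcs G"
proof
  assume "(v1, v2) \<in> parcs G"
  then show False
    using assms has_induced_C4[of c1 c2 v1 v2] C4 by (auto simp: hexagon_def intro: arcs_symmetric)
qed

text \<open>Otherwise \<open>c1 c2 c3 v2\<close> is an induced 4-cycle. Hence the \<open>c\<close>s
  never span exactly two edges.\<close>

lemma hexagon_trans:
  assumes "hexagon c1 c2 c3 v1 v2 v3" "(c1, c2) \<in> parcs G" "(c2, c3) \<in> parcs G"
  shows "(c1, c3) \<in> parcs G"
proof (rule ccontr)
  assume "(c1, c3) \<notin> parcs G"
  moreover have "c1 \<noteq> c3"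
    using assms(1) unfolding hexagon_def by blast
  ultimately show False
    using assms has_induced_C4[of c1 c2 c3 v2] C4 by (auto simp: hexagon_def intro: arcs_symmetric)
qed

text \<open>Otherwise \<open>v2 v3\<close> shortcuts the hexagon past \<open>c1\<close>, and the
  5-cycle \<open>c2 v1 c3 v2 v3\<close> is induced.\<close>

lemma hexagon_c_edge_imp_not_cross_edge:
  assumes h: "hexagon c1 c2 c3 v1 v2 v3" and c12: "(c1, c2) \<in> parcs G"
  shows "(v2, v3) \<notin> parcs G"
proof
  assume v23: "(v2, v3) \<in> parcs G"
  have v12: "(v1, v2) \<notin> parcs G"
    using hexagon_c_edge_imp_not_v_edge[OF h c12] .
  have c23: "(c2, c3) \<notin> parcs G"
    using hexagon_c_edge_imp_not_v_edge[OF hexagon_rotate[OF h]] v23 by blast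
  \<comment> \<open>The symmetries yield \<open>hexagon v1 v3 v2 c1 c3 c2\<close>, in which edges
    \<open>v1 v3\<close> and \<open>v3 v2\<close> would force \<open>v1 v2\<close>.\<close>
  have v13: "(v1, v3) \<notin> parcs G"
    using hexagon_trans[OF hexagon_swap[OF hexagon_rotate[OF hexagon_rotate[OF hexagon_flip[OF h]]]]]
      v12 v23 arcs_symmetric by blast
  show False
    using has_induced_C5[of c2 v1 c3 v2 v3] C5 h v12 c23 v13 v23
    unfolding hexagon_def by (metis arcs_symmetric)
qed

text \<open>By \<open>hexagon_trans\<close> the \<open>c\<close>s span three edges, none or one.
  Three give a sun with central triangle \<open>c1 c2 c3\<close>; none makes the hexagon an induced
  6-cycle; one shortcuts it to an induced 5-cycle.\<close>

lemma hexagon_independent: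
  assumes h: "hexagon c1 c2 c3 v1 v2 v3"
    and v: "(v1, v2) \<notin> parcs G" "(v2, v3) \<notin> parcs G" "(v3, v1) \<notin> parcs G"
  shows False
proof -
  have C5': False
    if h: "hexagon a b c x y z" and "(x, y) \<notin> parcs G"
      and "(a, b) \<in> parcs G" "(b, c) \<notin> parcs G" "(c, a) \<notin> parcs G" for a b c x y z
    using that has_induced_C5[of a b x c y] C5 unfolding hexagon_def by (metis arcs_symmetric)
  note h1 = hexagon_rotate[OF h]
  note h2 = hexagon_rotate[OF h1]
  consider "(c1, c2) \<in> parcs G" "(c2, c3) \<in> parcs G" "(c3, c1) \<in> parcs G"
    | "(c1, c2) \<notin> parcs G" "(c2, c3) \<notin> parcs G" "(c3, c1) \<notin> parcs G"
    | "(c1, c2) \<in> parcs G" "(c2, c3) \<notin> parcs G" "(c3, c1) \<notin> parcs G"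
    | "(c1, c2) \<notin> parcs G" "(c2, c3) \<in> parcs G" "(c3, c1) \<notin> parcs G"
    | "(c1, c2) \<notin> parcs G" "(c2, c3) \<notin> parcs G" "(c3, c1) \<in> parcs G"
    using hexagon_trans[OF h] hexagon_trans[OF h1] hexagon_trans[OF h2] arcs_symmetric by blast
  then show False
  proof cases
    case 1
    then show ?thesis
      using has_induced_sun3[of c1 c2 c3 v1 v2 v3] S3 h v unfolding hexagon_def
      by (metis arcs_symmetric)
  next
    case 2
    then show ?thesis
      using has_induced_C6[of c1 v3 c2 v1 c3 v2] C6 h v unfolding hexagon_def
      by (metis arcs_symmetric)
  qed (use C5'[OF h] C5'[OF h1] C5'[OF h2] v in blast)+
qed

text \<open>An edge among the \<open>c\<close>s excludes every edge among the \<open>v\<close>s, so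
  one of the two sides is independent, and \<open>hexagon_independent\<close> applies directly or
  after \<open>hexagon_flip\<close>.\<close>

lemma no_hexagon: "\<not> hexagon c1 c2 c3 v1 v2 v3"
proof
  assume h: "hexagon c1 c2 c3 v1 v2 v3"
  have indep: "(y, z) \<notin> parcs G \<and> (z, x) \<notin> parcs G \<and> (x, y) \<notin> parcs G"
    if "hexagon a b c x y z" "(a, b) \<in> parcs G" for a b c x y z
    using hexagon_c_edge_imp_not_v_edge[OF that] hexagon_c_edge_imp_not_cross_edge[OF that]
      hexagon_c_edge_imp_not_cross_edge[OF hexagon_swap[OF that(1)] arcs_symmetric[OF that(2)]]
      arcs_symmetric by blast
  note h1 = hexagon_rotate[OF h]
  note h2 = hexagon_rotate[OF h1]
  have "(c1, c2) \<notin> parcs G" "(c2, c3) \<notin> parcs G" "(c3, c1) \<notin> parcs G"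
    using indep[OF h] indep[OF h1] indep[OF h2] hexagon_independent[OF h] by blast+
  then show False
    using hexagon_independent[OF hexagon_flip[OF h]] by blast
qed

lemma closed_nbhd_hexagon:
  assumes "c1 \<in> closed_nbhd G v2" "c1 \<in> closed_nbhd G v3" "c2 \<in> closed_nbhd G v1"
      "c2 \<in> closed_nbhd G v3" "c3 \<in> closed_nbhd G v1" "c3 \<in> closed_nbhd G v2"
    and "c1 \<notin> closed_nbhd G v1" "c2 \<notin> closed_nbhd G v2" "c3 \<notin> closed_nbhd G v3"
  shows False
proof -
  \<comment> \<open>Each of the six coincidences is \<open>hexagon_degenerate\<close> with the
    indices permuted.\<close>
  have "c1 \<noteq> v2" "c1 \<noteq> v3" "c2 \<noteq> v1" "c2 \<noteq> v3" "c3 \<noteq> v1" "c3 \<noteq> v2"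
    using assms hexagon_degenerate[of c1 v3 c2 v1 c3] hexagon_degenerate[of c1 v2 c3 v1 c2]
      hexagon_degenerate[of c2 v3 c1 v2 c3] hexagon_degenerate[of c2 v1 c3 v2 c1]
      hexagon_degenerate[of c3 v2 c1 v3 c2] hexagon_degenerate[of c3 v1 c2 v3 c1]
      closed_nbhd_sym
    by blast+
  then have "hexagon c1 c2 c3 v1 v2 v3"
    using assms unfolding hexagon_def closed_nbhd_def
    by (auto simp: arcs_symmetric intro: not_parcs_sym)
  then show False
    using no_hexagon by blast
qed

end

end

section \<open>From hexagons to cliques of the square\<close>

theorem theorem3p2:
  fixes G :: "'a pair_pre_digraph" and C :: "'a set"
  assumes "pair_graph G"
    and "\<not> has_induced_copy G (cycle_graph 4)"
    and "\<not> has_induced_copy G (cycle_graph 5)"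
    and "\<not> has_induced_copy G (cycle_graph 6)"
    and "\<not> has_induced_copy G sun3"
    and "clique (square G) C"
    and "C \<noteq> {}"
  shows "\<exists>v\<in>pverts G. C \<subseteq> closed_nbhd G v"
proof -
  interpret pair_graph G by fact
  have sub: "C \<subseteq> pverts G" and "finite C"
    using assms(6) finite_subset[OF _ finite_verts] by (auto simp: clique_def square_def)
  have pair: "\<exists>w\<in>pverts G. {u, v} \<subseteq> closed_nbhd G w" if "u \<in> C" "v \<in> C" for u v
  proof (cases "u = v")
    case True
    then show ?thesis
      using that sub by (auto simp: closed_nbhd_def)
  next
    case False
    then have "graph_dist G u v \<le> 2"
      using assms(6) that by (auto simp: clique_def square_def)
    moreover have "u \<in> pverts G" "v \<in> pverts G"
      using that sub by auto
    ultimately consider "(u, v) \<in> parcs G" | w where "(u, w) \<in> parcs G" "(w, v) \<in> parcs G"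
      using graph_dist_le_2_iff[OF assms(1)] False by blast
    then show ?thesis
      using that sub
      by cases (auto simp: closed_nbhd_def dest: in_arcsD1 intro: arcs_symmetric)
  qed
  \<comment> \<open>Strong induction over the subsets of \<open>C\<close> takes the place of a
    minimal counterexample.\<close>
  have "\<exists>v\<in>pverts G. D \<subseteq> closed_nbhd G v" if "finite D" "D \<subseteq> C" "D \<noteq> {}" for D
    using that
  proof (induction D rule: finite_psubset_induct)
    case (psubset D)
    show ?case
    proof (cases "\<exists>c1 c2 c3. {c1, c2, c3} \<subseteq> D \<and> c1 \<noteq> c2 \<and> c1 \<noteq> c3 \<and> c2 \<noteq> c3")
      case False
      then obtain u v where "D = {u, v}"
        using psubset.prems(2) by blast
      then show ?thesis
        using pair psubset.prems(1) by blast
    next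
      case True
      then obtain c1 c2 c3 where c: "c1 \<in> D" "c2 \<in> D" "c3 \<in> D" "c1 \<noteq> c2" "c1 \<noteq> c3" "c2 \<noteq> c3"
        by blast
      \<comment> \<open>\<open>D\<close> has three distinct elements, so \<open>D - {c}\<close> is
        nonempty and the induction hypothesis applies.\<close>
      have omit: "\<exists>v\<in>pverts G. D - {c} \<subseteq> closed_nbhd G v" if "c \<in> D" for c
        by (rule psubset.IH) (use c that psubset.prems in auto)
      show ?thesis
      proof (rule ccontr)
        assume none: "\<not> ?thesis"
        have "\<exists>v. D - {c} \<subseteq> closed_nbhd G v \<and> c \<notin> closed_nbhd G v" if "c \<in> D" for c
          using omit[OF that] none by blast
        then obtain f where f: "\<And>c. c \<in> D \<Longrightarrow> D - {c} \<subseteq> closed_nbhd G (f c)"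
          "\<And>c. c \<in> D \<Longrightarrow> c \<notin> closed_nbhd G (f c)"
          by metis
        \<comment> \<open>\<open>f c1\<close>, \<open>f c2\<close>, \<open>f c3\<close> serve as
          \<open>v1\<close>, \<open>v2\<close>, \<open>v3\<close>.\<close>
        show False
          using closed_nbhd_hexagon[OF assms(2-5), of c1 "f c2" "f c3" c2 "f c1" c3] f c by blast
      qed
    qed
  qed
  then show ?thesis
    using \<open>finite C\<close> assms(7) by blast
qed

end
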